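(* Let $M=p^k\ge3$ be a prime power ($p$ prime, $k\ge1$), and let $\mathcal{A},\mathcal{B}\subset\{0,1,\dots,M-1\}$ with $1<|\mathcal{A}|=|\mathcal{B}|<M$. If $(\mathcal{A},\mathcal{B})$ is a distributed spectral pair in $\mathbb{Z}_M$, then $(\mathcal{A},\mathcal{B})$ is a spectral pair in $\mathbb{Z}_M$.
   Context: For a nonempty finite set $E\subset\mathbb{R}$, put $\widehat{\nu_E}(\xi)=\frac{1}{|E|}\sum_{a\in E}e^{-2\pi i\xi a}$ for $\xi\in\mathbb{R}$. Spectral pair: $(\mathcal{A},\mathcal{B})$ with $|\mathcal{A}|=|\mathcal{B}|$ is a spectral pair in $\mathbb{Z}_M$ if the matrix $\frac{1}{\sqrt{|\mathcal{A}|}}\left(e^{2\pi i ab/M}\right)_{a\in\mathcal{A},b\in\mathcal{B}}$ is unitary. Distributed spectral pair: $(\mathcal{A},\mathcal{B})$ with $|\mathcal{A}|=|\mathcal{B}|$ is a distributed spectral pair in $\mathbb{Z}_M$ if for all $b_1\neq b_1'$ in $\mathcal{B}$, either $\widehat{\nu_{\mathcal{A}}}\left(\frac{b_1-b_1'}{M}\right)=0$, or $\widehat{\nu_{\mathcal{A}}}\left(\frac{b_1-b_1'}{M^2}+\frac{b_2-b_2'}{M}\right)=0$ for all $b_2,b_2'\in\mathcal{B}$. *)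

theory Defs
  imports "HOL-Analysis.Analysis" "HOL-Computational_Algebra.Primes"
begin

definition nu_hat :: "real set \<Rightarrow> real \<Rightarrow> complex" where
  "nu_hat E \<xi> = (1 / of_nat (card E)) *
     (\<Sum>a\<in>E. exp (- 2 * of_real pi * \<i> * of_real \<xi> * of_real a))"

text \<open>
  A complex matrix with rows indexed by a finite set \<open>R\<close> and columns indexed by a
  finite set \<open>C\<close> is a function \<open>U\<close> restricted to \<open>R \<times> C\<close>. The two conjuncts are
  the entrywise forms of \<open>U\<^sup>* U = I\<close> (indexed by \<open>C\<close>) and \<open>U U\<^sup>* = I\<close> (indexed by \<open>R\<close>).
\<close>

definition unitary_on :: "'a set \<Rightarrow> 'b set \<Rightarrow> ('a \<Rightarrow> 'b \<Rightarrow> complex) \<Rightarrow> bool" where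
  "unitary_on R C U \<longleftrightarrow>
     (\<forall>c\<in>C. \<forall>c'\<in>C. (\<Sum>r\<in>R. cnj (U r c) * U r c') = (if c = c' then 1 else 0)) \<and>
     (\<forall>r\<in>R. \<forall>r'\<in>R. (\<Sum>c\<in>C. U r c * cnj (U r' c)) = (if r = r' then 1 else 0))"

definition spectral_pair :: "nat \<Rightarrow> int set \<Rightarrow> int set \<Rightarrow> bool" where
  "spectral_pair M A B \<longleftrightarrow>
     card A = card B \<and>
     unitary_on A B (\<lambda>a b. of_real (1 / sqrt (real (card A))) *
       exp (2 * of_real pi * \<i> * of_int a * of_int b / of_nat M))"

definition distributed_spectral_pair :: "nat \<Rightarrow> int set \<Rightarrow> int set \<Rightarrow> bool" where
  "distributed_spectral_pair M A B \<longleftrightarrow>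
     card A = card B \<and>
     (\<forall>b1\<in>B. \<forall>b1'\<in>B. b1 \<noteq> b1' \<longrightarrow>
        nu_hat (real_of_int ` A) (real_of_int (b1 - b1') / real M) = 0 \<or>
        (\<forall>b2\<in>B. \<forall>b2'\<in>B.
           nu_hat (real_of_int ` A)
             (real_of_int (b1 - b1') / (real M)^2 + real_of_int (b2 - b2') / real M) = 0))"

end

theory Submission
  imports Defs "HOL-Computational_Algebra.Polynomial"
begin

text \<open>
  The second alternative in the definition of a distributed spectral pair never occurs when
  \<open>M = p ^ k\<close>. Take \<open>b1 \<noteq> b1'\<close> in \<open>B\<close>, put \<open>d = b1 - b1'\<close>, and choose \<open>b2 = b2'\<close>, so that the
  frequency in question is \<open>d / M\<^sup>2\<close>. Since \<open>0 < \<bar>d\<bar> < p ^ k\<close>, the power of \<open>p\<close> dividing \<open>d\<close> is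
  some \<open>p ^ v\<close> with \<open>v < k\<close>, and hence \<open>exp (- 2 * pi * \<i> * d / M\<^sup>2)\<close> is a root of unity \<open>z\<close> of
  exact order \<open>p ^ (e + 1)\<close> with \<open>e = 2 * k - v - 1 \<ge> k\<close>. Its minimal polynomial over the rationals
  is the cyclotomic polynomial of degree \<open>p ^ e * (p - 1) \<ge> M\<close>. The mask polynomial
  \<open>\<Sum>a\<in>A. x ^ a\<close> is nonzero of degree less than \<open>M\<close>, so it cannot vanish at \<open>z\<close>, that is,
  \<open>nu_hat\<close> does not vanish at \<open>d / M\<^sup>2\<close> (\<open>nu_hat_nonzero_small_frequency\<close>).

  Hence the first alternative holds for all pairs of distinct elements of \<open>B\<close>, which says that
  the columns of the exponential matrix are orthonormal. Because \<open>A\<close> and \<open>B\<close> have the same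
  cardinality, this already makes the matrix unitary (\<open>unitary_onI_columns\<close>).

  The arithmetic input is the irreducibility of the cyclotomic polynomials of prime power
  order. It comes from Eisenstein's criterion after the substitution \<open>x \<mapsto> x + 1\<close>, and Gauss's lemma
  turns irreducibility over the integers into minimality of the degree among integer
  polynomials with a given root.
\<close>

section \<open>Integer polynomials with a common root\<close>

lemma map_poly_of_int_add:
  "map_poly of_int (f + g) = (map_poly of_int f + map_poly of_int g :: 'a::comm_ring_1 poly)"
  by (rule poly_eqI) (simp add: coeff_map_poly)

lemma map_poly_of_int_smult:
  "map_poly of_int (smult c f) = (smult (of_int c) (map_poly of_int f) :: 'a::comm_ring_1 poly)"
  by (rule poly_eqI) (simp add: coeff_map_poly)

lemma map_poly_of_int_mult:
  "map_poly of_int (f * g) = (map_poly of_int f * map_poly of_int g :: 'a::comm_ring_1 poly)"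
  by (rule poly_eqI) (simp add: coeff_map_poly coeff_mult)

text \<open>
  A primitive integer polynomial \<open>m\<close> of least degree vanishing at \<open>x\<close> divides a constant multiple
  of \<open>F\<close> by pseudo-division, and then divides \<open>F\<close> itself by Gauss's lemma. As \<open>F\<close> is irreducible
  and \<open>m\<close> is not constant, \<open>F\<close> and \<open>m\<close> have the same degree.
\<close>

lemma irreducible_int_poly_degree_le:
  fixes F f :: "int poly" and x :: "'a :: field_char_0"
  assumes irr: "irreducible F" and Fx: "poly (map_poly of_int F) x = 0"
    and f0: "f \<noteq> 0" and fx: "poly (map_poly of_int f) x = 0"
  shows "degree F \<le> degree f"
proof -
  define P where "P = (\<lambda>g::int poly. g \<noteq> 0 \<and> poly (map_poly of_int g) x = 0)"
  define g where "g = arg_min degree P"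
  have Pg: "P g" and g_min: "\<And>h. P h \<Longrightarrow> degree g \<le> degree h"
    using arg_min_natI[of P f degree] arg_min_nat_le[of P _ degree] f0 fx
    by (auto simp: g_def P_def)
  define m where "m = primitive_part g"
  have g: "g = smult (content g) m"
    by (simp add: m_def)
  have m0: "m \<noteq> 0" and cm: "content m = 1" and dm: "degree m = degree g"
    using Pg by (auto simp: m_def P_def)
  have "poly (map_poly of_int (smult (content g) m)) x = 0"
    using Pg g by (simp add: P_def)
  hence mx: "poly (map_poly of_int m) x = 0"
    using Pg by (simp add: map_poly_of_int_smult P_def)
  obtain q r where qr: "pseudo_divmod F m = (q, r)" by fastforce
  define c where "c = lead_coeff m ^ (Suc (degree F) - degree m)"
  have c0: "c \<noteq> 0" using m0 by (simp add: c_def)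
  have eq: "smult c F = m * q + r" and r: "r = 0 \<or> degree r < degree m"
    using pseudo_divmod[OF m0 qr] by (auto simp: c_def)
  have "poly (map_poly of_int (smult c F)) x = 0"
    by (simp add: map_poly_of_int_smult Fx)
  hence "poly (map_poly of_int r) x = 0"
    using mx by (simp add: eq map_poly_of_int_add map_poly_of_int_mult)
  hence "r = 0" using r g_min[of r] dm unfolding P_def by linarith
  with eq have eq: "smult c F = m * q" by simp
  \<comment> \<open>Contents are multiplicative and \<open>m\<close> is primitive, so the constant \<open>c\<close> is absorbed by \<open>q\<close>.\<close>
  have "normalize c * content F = content q"
    using arg_cong[OF eq, of content] by (simp add: content_mult cm)
  hence "c dvd content q" by (metis dvd_triv_left normalize_dvd_iff)
  then obtain q' where q': "q = smult c q'"
    using const_poly_dvd_iff_dvd_content[of c q] by (auto elim!: dvdE)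
  have F: "F = m * q'"
    using eq c0 by (simp add: q' poly_eq_iff)
  have "degree m \<noteq> 0"
  proof
    assume "degree m = 0"
    then obtain a where "m = [:a:]" by (rule degree_eq_zeroE)
    with m0 mx show False by (simp add: map_poly_pCons)
  qed
  hence "\<not> is_unit m" by (auto simp: is_unit_poly_iff)
  hence "is_unit q'" using irreducibleD[OF irr F] by blast
  hence "degree q' = 0" "q' \<noteq> 0" by (auto simp: is_unit_poly_iff)
  hence "degree F = degree m" using m0 by (simp add: F degree_mult_eq)
  with dm g_min[of f] f0 fx show ?thesis by (simp add: P_def)
qed

section \<open>Eisenstein's criterion\<close>

lemma monic_int_factor_degree_0_is_unit:
  fixes F :: "int poly"
  assumes "lead_coeff F = 1" "F = a * b" "degree a = 0"
  shows "is_unit a"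
proof -
  from assms(3) obtain c where c: "a = [:c:]" by (rule degree_eq_zeroE)
  have "lead_coeff a * lead_coeff b = 1"
    using assms by (simp add: lead_coeff_mult)
  hence "is_unit c" using c by (metis dvd_triv_left lead_coeff_pCons(2))
  thus ?thesis by (simp add: c is_unit_const_poly_iff)
qed

text \<open>
  The core of Eisenstein's argument. Let \<open>i\<close> be the least index at which the coefficient of \<open>a\<close>
  is not divisible by \<open>p\<close>. In the convolution for the coefficient of \<open>a * b\<close> at \<open>i\<close>, the term
  with the constant coefficient of \<open>b\<close> is the only one not divisible by \<open>p\<close>. Hence \<open>i\<close> is at
  least the degree of the product, which leaves no degree for \<open>b\<close>.
\<close>

lemma eisenstein_factor_is_unit:
  fixes F :: "int poly"
  assumes p: "prime p" and pF: "\<And>i. i < degree F \<Longrightarrow> p dvd coeff F i"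
    and monic: "lead_coeff F = 1" and F: "F = a * b" and b: "\<not> p dvd coeff b 0"
  shows "is_unit b"
proof -
  have nz: "a \<noteq> 0" "b \<noteq> 0" using F monic by auto
  have "lead_coeff a * lead_coeff b = 1"
    using monic F by (simp add: lead_coeff_mult)
  hence la: "\<not> p dvd lead_coeff a"
    using p by (metis dvd_trans dvd_triv_left not_prime_unit)
  define i where "i = (LEAST i. \<not> p dvd coeff a i)"
  have i: "\<not> p dvd coeff a i" and min: "\<And>j. j < i \<Longrightarrow> p dvd coeff a j"
    unfolding i_def using la LeastI[of "\<lambda>i. \<not> p dvd coeff a i"] not_less_Least by blast+
  have "i \<le> degree a" using la unfolding i_def by (rule Least_le)
  have "coeff F i = coeff a i * coeff b 0 + (\<Sum>j<i. coeff a j * coeff b (i - j))"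
    by (simp add: F coeff_mult lessThan_Suc_atMost[symmetric])
  moreover have "p dvd (\<Sum>j<i. coeff a j * coeff b (i - j))"
    using min by (intro dvd_sum) auto
  moreover have "\<not> p dvd coeff a i * coeff b 0"
    using p i b by (simp add: prime_dvd_mult_iff)
  ultimately have "\<not> p dvd coeff F i"
    by (metis dvd_add_left_iff)
  hence "degree F \<le> i" using pF by (meson not_less)
  with \<open>i \<le> degree a\<close> have "degree b = 0"
    using nz by (simp add: F degree_mult_eq)
  thus ?thesis
    using monic_int_factor_degree_0_is_unit[OF monic, of b a] F by (simp add: mult.commute)
qed

lemma eisenstein_criterion:
  fixes F :: "int poly"
  assumes p: "prime p" and pF: "\<And>i. i < degree F \<Longrightarrow> p dvd coeff F i"
    and monic: "lead_coeff F = 1" and deg: "degree F > 0" and sq: "\<not> p\<^sup>2 dvd coeff F 0"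
  shows "irreducible F"
proof (rule irreducibleI)
  show "F \<noteq> 0" "\<not> is_unit F" using deg by (auto simp: is_unit_poly_iff)
  fix a b assume F: "F = a * b"
  have "coeff F 0 = coeff a 0 * coeff b 0" by (simp add: F coeff_mult)
  with sq have "\<not> p dvd coeff a 0 \<or> \<not> p dvd coeff b 0"
    by (auto simp: power2_eq_square mult_dvd_mono)
  thus "is_unit a \<or> is_unit b"
    using eisenstein_factor_is_unit[OF p pF monic F] eisenstein_factor_is_unit[OF p pF monic, of b a] F
    by (auto simp: mult.commute)
qed

text \<open>
  Substituting \<open>x + c\<close> preserves degrees and products. Monicity then excludes constant factors
  that are not units.
\<close>

lemma irreducible_shift:
  fixes F :: "int poly"
  assumes monic: "lead_coeff F = 1" and irr: "irreducible (pcompose F [:c, 1:])"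
  shows "irreducible F"
proof (rule irreducibleI)
  show "F \<noteq> 0" using monic by auto
  show "\<not> is_unit F"
    using irr by (metis irreducible_not_unit is_unit_poly_iff pcompose_const)
  fix a b assume F: "F = a * b"
  have deg: "degree (pcompose g [:c, 1:]) = degree g" for g :: "int poly"
    by (simp add: degree_pcompose)
  from F have "pcompose F [:c, 1:] = pcompose a [:c, 1:] * pcompose b [:c, 1:]"
    by (simp add: pcompose_mult)
  hence "degree a = 0 \<or> degree b = 0"
    using irreducibleD[OF irr] by (metis deg degree_pCons_0 is_unit_poly_iff)
  thus "is_unit a \<or> is_unit b"
    using monic_int_factor_degree_0_is_unit[OF monic] F by (metis mult.commute)
qed

section \<open>Cyclotomic polynomials of prime power order\<close>

text \<open>
  The freshman's dream as a divisibility statement in a ring of arbitrary characteristic. It is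
  used for integer polynomials, where it controls powers of \<open>x + 1\<close> modulo \<open>p\<close>.
\<close>

lemma prime_dvd_freshmans_dream:
  fixes a b :: "'a :: comm_ring_1"
  assumes p: "prime p"
  shows "of_nat p dvd (a + b) ^ (p ^ e) - (a ^ (p ^ e) + b ^ (p ^ e))"
proof (induction e)
  case (Suc e)
  have base: "of_nat p dvd (u + v) ^ p - (u ^ p + v ^ p)" for u v :: 'a
  proof -
    have "p > 0" using p by (simp add: prime_gt_0_nat)
    have "(u + v) ^ p = (\<Sum>k\<le>p. of_nat (p choose k) * u ^ k * v ^ (p - k))"
      by (rule binomial_ring)
    also have "{..p} = insert 0 (insert p {0<..<p})" using \<open>p > 0\<close> by auto
    also have "(\<Sum>k\<in>\<dots>. of_nat (p choose k) * u ^ k * v ^ (p - k)) =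
        u ^ p + v ^ p + (\<Sum>k\<in>{0<..<p}. of_nat (p choose k) * u ^ k * v ^ (p - k))"
      using \<open>p > 0\<close> by simp
    finally have "(u + v) ^ p - (u ^ p + v ^ p) =
        (\<Sum>k\<in>{0<..<p}. of_nat (p choose k) * u ^ k * v ^ (p - k))" by simp
    also have "of_nat p dvd \<dots>"
    proof (rule dvd_sum)
      fix k assume "k \<in> {0<..<p}"
      hence "p dvd p choose k" using p by (intro dvd_choose_prime) auto
      hence "(of_nat p :: 'a) dvd of_nat (p choose k)"
        by (auto elim!: dvdE)
      thus "of_nat p dvd of_nat (p choose k) * u ^ k * v ^ (p - k)"
        by (simp add: mult.assoc)
    qed
    finally show ?thesis .
  qed
  let ?s = "(a + b) ^ p ^ e" and ?t = "a ^ p ^ e + b ^ p ^ e"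
  have "?s ^ p - ?t ^ p = (?s - ?t) * (\<Sum>i<p. ?t ^ (p - Suc i) * ?s ^ i)"
    by (rule power_diff_sumr2)
  with Suc have "of_nat p dvd ?s ^ p - ?t ^ p" by simp
  moreover have "of_nat p dvd ?t ^ p - ((a ^ p ^ e) ^ p + (b ^ p ^ e) ^ p)" by (rule base)
  ultimately have "of_nat p dvd (?s ^ p - ?t ^ p) + (?t ^ p - ((a ^ p ^ e) ^ p + (b ^ p ^ e) ^ p))"
    by (rule dvd_add)
  also have "(?s ^ p - ?t ^ p) + (?t ^ p - ((a ^ p ^ e) ^ p + (b ^ p ^ e) ^ p)) =
      ?s ^ p - ((a ^ p ^ e) ^ p + (b ^ p ^ e) ^ p)" by (simp add: algebra_simps)
  finally have "of_nat p dvd ?s ^ p - ((a ^ p ^ e) ^ p + (b ^ p ^ e) ^ p)" .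
  thus ?case by (simp only: power_Suc2 power_mult)
qed simp

text \<open>
  This is the cyclotomic polynomial of order \<open>p ^ (e + 1)\<close>. The exponent is shifted by one so that
  the degenerate order \<open>1\<close>, for which the formula would be wrong, does not arise.
\<close>

definition cyclotomic_prime_power :: "nat \<Rightarrow> nat \<Rightarrow> int poly" where
  "cyclotomic_prime_power p e = (\<Sum>t<p. monom 1 (p ^ e) ^ t)"

lemma cyclotomic_prime_power_mult:
  "(monom 1 (p ^ e) - 1) * cyclotomic_prime_power p e = monom 1 (p ^ Suc e) - 1"
  using power_diff_1_eq[of "monom (1::int) (p ^ e)" p]
  by (simp add: cyclotomic_prime_power_def monom_power mult.commute)

lemma monom_diff_1:
  assumes "n > 0"
  shows "degree (monom (1::int) n - 1) = n" "lead_coeff (monom (1::int) n - 1) = 1"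
proof -
  show *: "degree (monom (1::int) n - 1) = n"
  proof (rule antisym)
    show "degree (monom (1::int) n - 1) \<le> n" by (rule degree_diff_le) (auto simp: degree_monom_le)
    show "n \<le> degree (monom (1::int) n - 1)" using assms by (intro le_degree) simp
  qed
  show "lead_coeff (monom (1::int) n - 1) = 1" unfolding * using assms by simp
qed

lemma cyclotomic_prime_power_degree:
  assumes p: "prime p"
  shows "degree (cyclotomic_prime_power p e) = p ^ e * (p - 1)"
    and "lead_coeff (cyclotomic_prime_power p e) = 1"
proof -
  let ?C = "cyclotomic_prime_power p e"
  have pos: "p ^ e > 0" "p ^ Suc e > 0" using p by (auto simp: prime_gt_0_nat)
  note eq = cyclotomic_prime_power_mult[of p e]
  show "lead_coeff ?C = 1"
    using arg_cong[OF eq, of lead_coeff] monom_diff_1[OF pos(1)] monom_diff_1[OF pos(2)]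
    by (simp only: lead_coeff_mult mult_1)
  hence "?C \<noteq> 0" by auto
  moreover have "monom (1::int) (p ^ e) - 1 \<noteq> 0" using monom_diff_1(2)[OF pos(1)] by force
  ultimately have "p ^ e + degree ?C = p ^ Suc e"
    using arg_cong[OF eq, of degree] monom_diff_1(1)[OF pos(1)] monom_diff_1(1)[OF pos(2)]
    by (subst (asm) degree_mult_eq) auto
  thus "degree ?C = p ^ e * (p - 1)" by (simp add: algebra_simps)
qed

text \<open>
  With \<open>q = p ^ e\<close> and \<open>F\<close> the polynomial after the substitution \<open>x \<mapsto> x + 1\<close>, the identity
  \<open>((x + 1) ^ q - 1) * F = (x + 1) ^ (p * q) - 1\<close> reads \<open>x ^ q * F = x ^ (p * q)\<close> modulo \<open>p\<close>.
  So all coefficients of \<open>F\<close> below the leading one are divisible by \<open>p\<close>. The constant coefficient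
  of \<open>F\<close> is the value of the cyclotomic polynomial at \<open>1\<close>, which is exactly \<open>p\<close>, so Eisenstein's
  criterion applies.
\<close>

lemma irreducible_cyclotomic_prime_power:
  assumes p: "prime p"
  shows "irreducible (cyclotomic_prime_power p e)"
proof (rule irreducible_shift)
  let ?C = "cyclotomic_prime_power p e" and ?y = "[:1, 1:] :: int poly"
  show monic: "lead_coeff ?C = 1" using cyclotomic_prime_power_degree[OF p] by simp
  have p1: "p > 1" using p by (rule prime_gt_1_nat)
  define q where "q = p ^ e"
  define F where "F = pcompose ?C ?y"
  have dF: "degree F = q * (p - 1)"
    by (simp add: F_def degree_pcompose cyclotomic_prime_power_degree[OF p] q_def)
  have y: "monom 1 n \<circ>\<^sub>p ?y = ?y ^ n" for n
    by (induction n) (simp_all add: monom_0 monom_Suc pcompose_pCons pcompose_1 flip: one_pCons)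
  have prod: "(?y ^ q - 1) * F = ?y ^ (p ^ Suc e) - 1"
    using arg_cong[OF cyclotomic_prime_power_mult[of p e], of "\<lambda>f. pcompose f ?y"]
    by (simp add: pcompose_mult pcompose_diff pcompose_1 y F_def q_def)
  have split: "?y = monom 1 1 + 1" by (simp add: monom_altdef one_pCons)
  obtain V where V: "?y ^ q - (monom 1 q + 1) = of_nat p * V"
    using prime_dvd_freshmans_dream[OF p, of "monom (1::int) 1" 1 e]
    by (auto simp: monom_power q_def split elim!: dvdE)
  obtain W where W: "?y ^ (p ^ Suc e) - (monom 1 (p ^ Suc e) + 1) = of_nat p * W"
    using prime_dvd_freshmans_dream[OF p, of "monom (1::int) 1" 1 "Suc e"]
    by (auto simp: monom_power split simp del: power_Suc elim!: dvdE)
  have "monom 1 q = (?y ^ q - 1) - of_nat p * V"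
    using V by (metis add_diff_cancel_right' diff_diff_add diff_diff_eq2 add.commute)
  hence "monom 1 q * F = (?y ^ q - 1) * F - of_nat p * V * F"
    by (simp only: left_diff_distrib)
  also have "(?y ^ q - 1) * F = monom 1 (p ^ Suc e) + of_nat p * W"
    unfolding prod using W by (simp only: diff_eq_eq ac_simps)
  finally have "monom 1 q * F = monom 1 (p ^ Suc e) + of_nat p * (W - V * F)"
    by (simp only: right_diff_distrib mult.assoc add_diff_eq)
  hence co: "coeff (monom 1 q * F) j = coeff (monom 1 (p ^ Suc e) + of_nat p * (W - V * F)) j" for j
    by simp
  show "irreducible F"
  proof (rule eisenstein_criterion[of "int p"])
    show "prime (int p)" using p by simp
    show "lead_coeff F = 1" unfolding F_def using monic by (subst lead_coeff_comp) auto
    show "degree F > 0" using p1 by (simp add: dF q_def)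
    have "coeff F 0 = poly ?C 1"
      by (simp add: F_def poly_pcompose flip: poly_0_coeff_0)
    also have "\<dots> = int p" by (simp add: cyclotomic_prime_power_def poly_sum poly_monom)
    finally show "\<not> (int p)\<^sup>2 dvd coeff F 0"
      using p1 by (auto simp: power2_eq_square dest!: zdvd_imp_le)
    fix i assume i: "i < degree F"
    have "q + i \<noteq> p ^ Suc e" using i p1 by (simp add: dF q_def algebra_simps diff_mult_distrib2)
    thus "int p dvd coeff F i"
      using co[of "q + i"] by (simp add: coeff_monom_mult of_nat_poly)
  qed
qed

text \<open>
  The two conditions on \<open>z\<close> say that it has exact order \<open>p ^ (e + 1)\<close>, so that it is a root of the
  irreducible polynomial above and of no nonzero polynomial of smaller degree.
\<close>

lemma prime_power_root_of_unity_nonvanishing: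
  fixes z :: "'a :: field_char_0" and f :: "int poly"
  assumes p: "prime p" and z: "z ^ (p ^ Suc e) = 1" "z ^ (p ^ e) \<noteq> 1"
    and f: "f \<noteq> 0" "degree f < p ^ e * (p - 1)"
  shows "poly (map_poly of_int f) z \<noteq> 0"
proof
  assume fz: "poly (map_poly of_int f) z = 0"
  let ?C = "cyclotomic_prime_power p e"
  have "map_poly of_int (monom 1 n - 1) = (monom 1 n - 1 :: 'a poly)" for n
    by (rule poly_eqI) (simp add: coeff_map_poly)
  hence m: "poly (map_poly of_int (monom 1 n - 1)) z = z ^ n - 1" for n
    by (simp add: poly_monom)
  have "(z ^ (p ^ e) - 1) * poly (map_poly of_int ?C) z = z ^ (p ^ Suc e) - 1"
    using arg_cong[OF cyclotomic_prime_power_mult[of p e], of "\<lambda>f. poly (map_poly of_int f) z"]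
    by (simp only: map_poly_of_int_mult poly_mult m)
  hence "poly (map_poly of_int ?C) z = 0" using z by simp
  from irreducible_int_poly_degree_le[OF irreducible_cyclotomic_prime_power[OF p] this f(1) fz]
  show False using f(2) cyclotomic_prime_power_degree[OF p] by simp
qed

section \<open>Square matrices with orthonormal columns\<close>

text \<open>
  Let \<open>P = U U\<^sup>*\<close> and let \<open>n\<close> be the common number of rows and columns. Orthonormality of the
  columns gives \<open>P\<close> trace \<open>n\<close> and squared Frobenius norm \<open>n\<close>. Therefore \<open>P - I\<close> has squared
  Frobenius norm \<open>n - 2 n + n = 0\<close>.
\<close>

lemma unitary_onI_columns:
  fixes U :: "'a \<Rightarrow> 'b \<Rightarrow> complex"
  assumes fin: "finite R" "finite C" and card: "card R = card C"
    and col: "\<And>c c'. c \<in> C \<Longrightarrow> c' \<in> C \<Longrightarrow>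
      (\<Sum>r\<in>R. cnj (U r c) * U r c') = (if c = c' then 1 else 0)"
  shows "unitary_on R C U"
proof -
  define P where "P = (\<lambda>r r'. \<Sum>c\<in>C. U r c * cnj (U r' c))"
  define n :: complex where "n = of_nat (card C)"
  let ?d = "\<lambda>r r'. if r = r' then 1 else 0 :: complex"
  have tr: "(\<Sum>r\<in>R. P r r) = n"
  proof -
    have "(\<Sum>r\<in>R. P r r) = (\<Sum>c\<in>C. \<Sum>r\<in>R. cnj (U r c) * U r c)"
      unfolding P_def by (subst sum.swap) (simp add: mult.commute)
    also have "\<dots> = n" by (simp add: col n_def)
    finally show ?thesis .
  qed
  have frob: "(\<Sum>r\<in>R. \<Sum>r'\<in>R. P r r' * cnj (P r r')) = n"
  proof -
    have "(\<Sum>r\<in>R. \<Sum>r'\<in>R. P r r' * cnj (P r r')) =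
      (\<Sum>r\<in>R. \<Sum>r'\<in>R. \<Sum>c\<in>C. \<Sum>c'\<in>C. (cnj (U r c') * U r c) * (cnj (U r' c) * U r' c'))"
      by (simp add: P_def sum_product mult_ac)
    also have "\<dots> = (\<Sum>r\<in>R. \<Sum>c\<in>C. \<Sum>c'\<in>C. \<Sum>r'\<in>R. (cnj (U r c') * U r c) * (cnj (U r' c) * U r' c'))"
      by (intro sum.cong refl, subst sum.swap, intro sum.cong refl, subst sum.swap, rule refl)
    also have "\<dots> = (\<Sum>c\<in>C. \<Sum>c'\<in>C. \<Sum>r\<in>R. \<Sum>r'\<in>R. (cnj (U r c') * U r c) * (cnj (U r' c) * U r' c'))"
      by (subst sum.swap, intro sum.cong refl, subst sum.swap, rule refl)
    also have "\<dots> = (\<Sum>c\<in>C. \<Sum>c'\<in>C. (\<Sum>r\<in>R. cnj (U r c') * U r c) * (\<Sum>r'\<in>R. cnj (U r' c) * U r' c'))"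
      by (simp add: sum_product)
    also have "\<dots> = (\<Sum>c\<in>C. \<Sum>c'\<in>C. if c = c' then 1 else 0)"
      by (intro sum.cong refl) (simp add: col)
    also have "\<dots> = n" using fin by (simp add: n_def)
    finally show ?thesis .
  qed
  have "of_real (\<Sum>r\<in>R. \<Sum>r'\<in>R. (cmod (P r r' - ?d r r'))\<^sup>2) =
      (\<Sum>r\<in>R. \<Sum>r'\<in>R. P r r' * cnj (P r r') - ?d r r' * (P r r' + cnj (P r r')) + ?d r r')"
    by (auto simp: complex_norm_square algebra_simps simp del: of_real_power intro!: sum.cong)
  also have "\<dots> = n - (n + cnj n) + n"
    using fin by (simp add: sum.distrib sum_subtractf frob if_distrib[of "\<lambda>x. x * _"] tr card n_def
        flip: cnj_sum cong: if_cong)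
  also have "\<dots> = 0" by (simp add: n_def)
  finally have "(\<Sum>r\<in>R. \<Sum>r'\<in>R. (cmod (P r r' - ?d r r'))\<^sup>2) = 0"
    by (simp only: of_real_eq_0_iff)
  hence "\<forall>r\<in>R. \<forall>r'\<in>R. P r r' = ?d r r'"
    using fin by (simp add: sum_nonneg_eq_0_iff sum_nonneg)
  thus ?thesis using col unfolding unitary_on_def P_def by blast
qed


section \<open>Nonvanishing of the Fourier transform\<close>

text \<open>
  Up to the factor \<open>1 / card A\<close>, \<open>nu_hat\<close> is the mask polynomial \<open>\<Sum>a\<in>A. x ^ a\<close> evaluated at \<open>z\<close>.
\<close>

lemma nu_hat_nonzero_at_prime_power_root:
  fixes A :: "int set" and \<xi> :: real
  defines "z \<equiv> exp (- 2 * of_real pi * \<i> * of_real \<xi>)"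
  assumes p: "prime p" and A: "A \<noteq> {}" "A \<subseteq> {0..<int (p ^ e * (p - 1))}"
    and z: "z ^ (p ^ Suc e) = 1" "z ^ (p ^ e) \<noteq> 1"
  shows "nu_hat (real_of_int ` A) \<xi> \<noteq> 0"
proof -
  have fin: "finite A" using A(2) by (rule finite_subset) simp
  define f :: "int poly" where "f = (\<Sum>a\<in>A. monom 1 (nat a))"
  have fz: "poly (map_poly of_int f) z = (\<Sum>a\<in>A. z ^ nat a)"
    unfolding f_def using fin
    by (induction A rule: finite_induct) (simp_all add: map_poly_of_int_add map_poly_monom poly_monom)
  \<comment> \<open>The value at \<open>1\<close> shows that the mask polynomial is not zero.\<close>
  have "poly f 1 = int (card A)" by (simp add: f_def poly_sum poly_monom)
  hence f0: "f \<noteq> 0" using A(1) fin by auto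
  have "degree f < p ^ e * (p - 1)"
    unfolding f_def
  proof (rule degree_sum_less)
    show "0 < p ^ e * (p - 1)" using p by (simp add: prime_gt_0_nat prime_gt_Suc_0_nat)
    fix a assume "a \<in> A"
    hence "nat a < p ^ e * (p - 1)" using A(2) by (auto simp: nat_less_iff)
    thus "degree (monom (1::int) (nat a)) < p ^ e * (p - 1)" by (simp add: degree_monom_eq)
  qed
  from prime_power_root_of_unity_nonvanishing[OF p z f0 this]
  have "(\<Sum>a\<in>A. z ^ nat a) \<noteq> 0" using fz by simp
  also have "(\<Sum>a\<in>A. z ^ nat a) =
      (\<Sum>a\<in>A. exp (- 2 * of_real pi * \<i> * of_real \<xi> * of_real (real_of_int a)))"
  proof (rule sum.cong)
    fix a assume "a \<in> A"
    hence "of_int a = (of_nat (nat a) :: complex)" using A(2) by auto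
    thus "z ^ nat a = exp (- 2 * of_real pi * \<i> * of_real \<xi> * of_real (real_of_int a))"
      by (simp add: z_def mult_ac flip: exp_of_nat_mult)
  qed simp
  finally show ?thesis
    using A(1) fin by (simp add: nu_hat_def sum.reindex inj_on_def)
qed

text \<open>
  Frequencies \<open>d / M\<^sup>2\<close> with \<open>0 < \<bar>d\<bar> < M\<close> have a denominator so large that the corresponding
  cyclotomic polynomial has degree at least \<open>M\<close>: dividing out the power of \<open>p\<close> in \<open>d\<close> leaves
  a denominator divisible by \<open>p * M\<close>.
\<close>

lemma nu_hat_nonzero_small_frequency:
  fixes A :: "int set" and d :: int
  assumes p: "prime p" and A: "A \<noteq> {}" "A \<subseteq> {0..<int (p ^ k)}"
    and d: "d \<noteq> 0" "\<bar>d\<bar> < int (p ^ k)"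
  shows "nu_hat (real_of_int ` A) (real_of_int d / real (p ^ k) ^ 2) \<noteq> 0"
proof -
  have p1: "p > 1" using p by (rule prime_gt_1_nat)
  have pint: "prime (int p)" using p by simp
  obtain v d' where d': "d = int p ^ v * d'" "\<not> int p dvd d'"
    using multiplicity_decompose'[of d "int p"] d(1) pint by (metis not_prime_unit)
  have "p ^ v < p ^ k"
  proof -
    have "int p ^ v dvd d" by (simp add: d')
    hence "int p ^ v \<le> \<bar>d\<bar>" using d(1) by (intro zdvd_imp_le) auto
    hence "int (p ^ v) < int (p ^ k)" using d(2) by simp
    thus ?thesis by (simp only: of_nat_less_iff)
  qed
  hence vk: "v < k" using p1 by simp
  define e where "e = 2 * k - v - 1"
  have ke: "k \<le> e" and vSe: "v + Suc e = 2 * k" using vk by (auto simp: e_def)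
  let ?\<xi> = "real_of_int d / real (p ^ k) ^ 2"
  have "?\<xi> = (real p ^ v * of_int d') / real p ^ (v + Suc e)"
    unfolding vSe by (simp add: d' power_mult mult.commute)
  hence xi: "?\<xi> = of_int d' / real p ^ Suc e" using p1 by (simp add: power_add)
  let ?z = "exp (- 2 * of_real pi * \<i> * of_real ?\<xi>) :: complex"
  have zn: "?z ^ n = exp (\<i> * of_real (- 2 * pi * (real n * (of_int d' / real p ^ Suc e))))" for n
    unfolding xi by (subst exp_of_nat_mult[symmetric]) (simp add: mult_ac)
  show ?thesis
  proof (rule nu_hat_nonzero_at_prime_power_root[OF p A(1), of e])
    have "p ^ k \<le> p ^ e * (p - 1)"
      using mult_le_mono[OF power_increasing[OF ke, of p], of 1 "p - 1"] p1 by simp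
    thus "A \<subseteq> {0..<int (p ^ e * (p - 1))}"
      using A(2) by (force simp del: of_nat_mult of_nat_power)
    show "?z ^ p ^ Suc e = 1"
      unfolding zn exp_eq_1 using p1 by (auto intro!: exI[of _ "-d'"])
    show "?z ^ p ^ e \<noteq> 1"
    proof
      assume "?z ^ p ^ e = 1"
      moreover have Im_eq: "Im (\<i> * of_real x) = x" for x by simp
      ultimately obtain n :: int where
        n: "- 2 * pi * (real (p ^ e) * (of_int d' / real p ^ Suc e)) = of_int (2 * n) * pi"
        unfolding zn exp_eq_1 Im_eq by blast
      have cancel: "real (p ^ e) * (of_int d' / real p ^ Suc e) = of_int d' / real p"
        using p1 by simp
      have "- x = of_int n" if "- 2 * pi * x = of_int (2 * n) * pi" for x
      proof -
        have "(2 * pi) * (- x) = (2 * pi) * of_int n" using that by simp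
        thus ?thesis by (subst (asm) mult_left_cancel) simp_all
      qed
      from this[OF n[unfolded cancel]] have "- of_int d' / real p = of_int n"
        by (simp only: minus_divide_left)
      hence "- of_int d' = of_int n * real p"
        using p1 by (subst (asm) divide_eq_eq) auto
      hence "of_int (- d') = real_of_int (n * int p)" by simp
      hence "- d' = n * int p" by (simp only: of_int_eq_iff)
      with d'(2) show False by (metis dvd_minus_iff dvd_triv_right)
    qed
  qed
qed

section \<open>Distributed spectral pairs are spectral pairs\<close>

text \<open>
  The inner product of the columns \<open>b\<close> and \<open>b'\<close> of the exponential matrix is the value of \<open>nu_hat\<close>
  at \<open>(b - b') / M\<close>.
\<close>

lemma spectral_pairI:
  fixes A B :: "int set"
  assumes card: "card A = card B" "card A > 0"
    and zero: "\<And>b b'. b \<in> B \<Longrightarrow> b' \<in> B \<Longrightarrow> b \<noteq> b' \<Longrightarrow>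
      nu_hat (real_of_int ` A) (real_of_int (b - b') / real M) = 0"
  shows "spectral_pair M A B"
  unfolding spectral_pair_def
proof (intro conjI unitary_onI_columns)
  show fin: "finite A" "finite B" using card card_gt_0_iff by metis+
  show "card A = card B" "card A = card B" by fact+
  fix b b' assume b: "b \<in> B" "b' \<in> B"
  let ?U = "\<lambda>a b. of_real (1 / sqrt (real (card A))) *
       exp (2 * of_real pi * \<i> * of_int a * of_int b / of_nat M) :: complex"
  have sq: "complex_of_real (sqrt (real (card A))) * of_real (sqrt (real (card A))) = of_nat (card A)"
    by (simp flip: of_real_mult)
  have "cnj (?U a b) * ?U a b' = 1 / of_nat (card A) *
      exp (- 2 * of_real pi * \<i> * of_real (real_of_int (b - b') / real M) * of_real (real_of_int a))" for a
    by (simp add: exp_cnj sq mult_ac flip: exp_add) (simp add: field_simps diff_divide_distrib)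
  hence "(\<Sum>a\<in>A. cnj (?U a b) * ?U a b') =
      nu_hat (real_of_int ` A) (real_of_int (b - b') / real M)"
    by (simp add: nu_hat_def sum.reindex inj_on_def card_image sum_distrib_left del: complex_cnj_mult)
  thus "(\<Sum>a\<in>A. cnj (?U a b) * ?U a b') = (if b = b' then 1 else 0)"
    using zero[OF b] card(2) by (auto simp: nu_hat_def card_image inj_on_def)
qed

theorem theorem4p1:
  fixes M p k :: nat and A B :: "int set"
  assumes "prime p" and "k \<ge> 1" and "M = p ^ k" and "M \<ge> 3"
    and "A \<subseteq> {0..int M - 1}" and "B \<subseteq> {0..int M - 1}"
    and "1 < card A" and "card A = card B" and "card B < M"
    and "distributed_spectral_pair M A B"
  shows "spectral_pair M A B"
proof (rule spectral_pairI)
  show "card A = card B" "card A > 0" using assms by auto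
  fix b b' assume b: "b \<in> B" "b' \<in> B" "b \<noteq> b'"
  have "nu_hat (real_of_int ` A) (real_of_int (b - b') / (real (p ^ k))\<^sup>2) \<noteq> 0"
  proof (rule nu_hat_nonzero_small_frequency[OF assms(1)])
    show "A \<noteq> {}" using assms(7) by auto
    show "A \<subseteq> {0..<int (p ^ k)}" using assms(3,5) by auto
    show "\<bar>b - b'\<bar> < int (p ^ k)"
      using subsetD[OF assms(6) b(1)] subsetD[OF assms(6) b(2)] assms(3) by auto
  qed (use b in simp)
  \<comment> \<open>The choice \<open>b2 = b2'\<close> refutes the second alternative.\<close>
  hence "\<not> (\<forall>b2\<in>B. \<forall>b2'\<in>B. nu_hat (real_of_int ` A)
      (real_of_int (b - b') / (real M)\<^sup>2 + real_of_int (b2 - b2') / real M) = 0)"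
    using b(1) assms(3) by (auto intro!: bexI[of _ b])
  thus "nu_hat (real_of_int ` A) (real_of_int (b - b') / real M) = 0"
    using assms(10) b unfolding distributed_spectral_pair_def by blast
qed

end
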